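(* For all integers $k,s$ with $5\le k\le s$, $$R(k+1,s+1)\ge R(k,s)+2k+2s.$$ By symmetry, the same inequality holds after interchanging $k$ and $s$ whenever $\min\{k,s\}\ge 5$; that is, $R(k+1,s+1)\ge R(k,s)+2k+2s$ holds for all integers $k,s\ge 5$.
   Context: For positive integers $k,s$, the classical two-color Ramsey number $R(k,s)$ is the smallest integer $n$ such that every coloring of the edges of the complete graph $K_n$ with the two colors red and blue contains a red copy of $K_k$ (a set of $k$ vertices all of whose pairs are red) or a blue copy of $K_s$ (a set of $s$ vertices all of whose pairs are blue). *)

theory Defs
  imports Complex_Main "HOL-Library.Ramsey"
begin

text \<open>
  The library's \<^term>\<open>partn_lst {..<n} [k, s] 2\<close> quantifies over the colourings of the edges
  (the 2-subsets) of the complete graph on \<^term>\<open>{..<n}\<close> with the colours 0 (red) and 1 (blue);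
  the list gives the size of the monochromatic vertex set sought in each colour.
\<close>

definition ramsey_number :: "nat \<Rightarrow> nat \<Rightarrow> nat" where
  "ramsey_number k s = (LEAST n. partn_lst {..<n} [k, s] 2)"

text \<open>The minimum is over a nonempty set, by Ramsey's theorem.\<close>

lemma partn_lst_ramsey_number: "partn_lst {..<ramsey_number k s} [k, s] 2"
  unfolding ramsey_number_def using ramsey_full[of "[k, s]" 2] by (rule LeastI_ex)

lemma partn_lst_two_colours_iff:
  fixes n k s :: nat
  shows "partn_lst {..<n} [k, s] 2 \<longleftrightarrow>
    (\<forall>c \<in> [{..<n}]\<^bsup>2\<^esup> \<rightarrow> {0, 1::nat}.
       (\<exists>H\<subseteq>{..<n}. card H = k \<and> (\<forall>e\<in>[H]\<^bsup>2\<^esup>. c e = 0)) \<or>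
       (\<exists>H\<subseteq>{..<n}. card H = s \<and> (\<forall>e\<in>[H]\<^bsup>2\<^esup>. c e = 1)))"
proof -
  have mono: "monochromatic {..<n} m 2 c i \<longleftrightarrow>
      (\<exists>H\<subseteq>{..<n}. card H = m \<and> (\<forall>e\<in>[H]\<^bsup>2\<^esup>. c e = i))" for m and c :: "nat set \<Rightarrow> nat" and i
    unfolding monochromatic_def nsets_def[of "{..<n}"]
    by (auto simp: image_subset_iff intro: finite_subset[OF _ finite_lessThan])
  have len: "{..<length [k, s]} = {0, 1}" by auto
  have ex: "(\<exists>i<length [k, s]. P i) \<longleftrightarrow> P 0 \<or> P 1" for P
    by (auto simp: less_Suc_eq)
  show ?thesis
    unfolding partn_lst_def len ex mono by simp
qed

end

theory Submission
  imports Defs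
begin

text \<open>
  Colours are booleans, \<^term>\<open>True\<close> for red and \<^term>\<open>False\<close> for blue; write \<open>L p\<close> for the clique
  size forbidden in colour \<open>p\<close>, so that \<open>L True = k\<close> and \<open>L False = s\<close>. Take a colouring \<open>G\<close> on
  \<open>R(k,s) - 1\<close> vertices without a clique of colour \<open>p\<close> and size \<open>L p\<close>, for either \<open>p\<close>. The proof adds
  \<open>2k + 2s\<close> vertices to \<open>G\<close> in such a way that cliques of colour \<open>p\<close> grow by at most one, that is, to
  size at most \<open>L p\<close>.

  Since \<open>G\<close> has as many vertices as possible, every vertex \<open>v\<close> lies in a \<open>p\<close>-clique of size \<open>L p - 1\<close>
  for both colours: otherwise a twin of \<open>v\<close>, joined to \<open>v\<close> in colour \<open>p\<close>, could be added
  (\<open>critical_vertex_in_clique\<close>). Fix \<open>v\<close> and, for each \<open>p\<close>, the other \<open>L p - 2\<close> vertices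
  \<open>w p 0, w p 1, ...\<close> of such a clique. The new colouring consists of

  \<^item> \<open>G\<close> with \<open>v\<close> replaced by a pentagon of five twins, red along the 5-cycle and blue along
    its complement, which is again a 5-cycle (four more vertices);
  \<^item> a twin \<open>Copy p j\<close> of each \<open>w p j\<close>, joined to \<open>w p j\<close> in the colour \<open>\<not> p\<close>
    (\<open>k + s - 4\<close> more vertices);
  \<^item> for each \<open>p\<close> a \<open>p\<close>-clique of \<open>L p\<close> vertices \<open>Join p j\<close>, joined to \<open>G\<close> in the colour \<open>\<not> p\<close>
    with few exceptions (\<open>k + s\<close> more vertices).

  Call a \<open>p\<close>-coloured edge between vertices outside the joins faithful if it projects to a
  \<open>p\<close>-coloured edge of \<open>G\<close>. If a \<open>p\<close>-clique \<open>K\<close> has no vertex \<open>Join p j\<close>, then deleting one vertex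
  makes all its edges faithful: a pentagon has no monochromatic triangle, and two \<open>p\<close>-coloured twin
  pairs cannot lie in the same \<open>K\<close> because the \<open>w (\<not> p) i\<close> together with \<open>v\<close> form a
  \<open>(\<not> p)\<close>-clique. So \<open>K\<close> has at most \<open>(L p - 1) + 1\<close> vertices (\<open>card_clique_without_join\<close>).

  If \<open>K\<close> does contain some \<open>Join p j\<close>, then it meets \<open>G\<close> minus the pentagon in at most one vertex, and
  counting takes over: \<open>Join p j\<close> and \<open>Copy p j\<close> are joined in the colour \<open>\<not> p\<close>, so at most one
  vertex per index \<open>j < L p\<close> is used, and each pentagon vertex and each \<open>Join (\<not> p) i\<close> in \<open>K\<close> has to be
  paid for by an index left unused. Such indices are provided by some edges of
  colour \<open>\<not> p\<close> between the vertices \<open>Copy p j\<close>, \<open>Join p j\<close>, the pentagon and the vertices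
  \<open>Join (\<not> p) i\<close>. A vertex of \<open>G\<close> outside the pentagon can only be \<open>w p j\<close>, and it is paid for by the
  loss of all other \<open>Join p l\<close> (\<open>card_clique_join_old\<close>). The edges mentioned are distributed so that
  they create no large \<open>(\<not> p)\<close>-clique either. They need three kinds of vertices \<open>w p j\<close> (\<open>j = 0\<close>, \<open>j = 1\<close> and \<open>j \<ge> 2\<close>), that is \<open>L p - 2 \<ge> 3\<close>, which
  is where \<open>k, s \<ge> 5\<close> enters.
\<close>

section \<open>Colourings without large monochromatic cliques\<close>

definition mono_clique :: "('a \<Rightarrow> 'a \<Rightarrow> bool) \<Rightarrow> bool \<Rightarrow> 'a set \<Rightarrow> bool" where
  "mono_clique c p K \<longleftrightarrow> (\<forall>x\<in>K. \<forall>y\<in>K. x \<noteq> y \<longrightarrow> c x y = p)"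

lemma mono_cliqueD: "mono_clique c p K \<Longrightarrow> x \<in> K \<Longrightarrow> y \<in> K \<Longrightarrow> x \<noteq> y \<Longrightarrow> c x y = p"
  by (auto simp: mono_clique_def)

definition avoiding :: "'a set \<Rightarrow> ('a \<Rightarrow> 'a \<Rightarrow> bool) \<Rightarrow> (bool \<Rightarrow> nat) \<Rightarrow> bool" where
  "avoiding X c L \<longleftrightarrow> (\<forall>x y. c x y = c y x) \<and>
     (\<forall>p K. K \<subseteq> X \<longrightarrow> mono_clique c p K \<longrightarrow> card K < L p)"

text \<open>
  A symmetric function on pairs of vertices is easier to extend to new vertices than a colouring
  of two-element sets, so all constructions below are done with the former.
\<close>

lemma not_partn_lst_iff_avoiding:
  fixes n k s :: nat
  shows "\<not> partn_lst {..<n} [k, s] 2 \<longleftrightarrow> (\<exists>c. avoiding {..<n} c (\<lambda>p. if p then k else s))"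
proof
  assume "\<not> partn_lst {..<n} [k, s] 2"
  note none = this[unfolded partn_lst_two_colours_iff]
  have "\<exists>f\<in>[{..<n}]\<^bsup>2\<^esup> \<rightarrow> {0, 1::nat}.
      \<not> ((\<exists>H\<subseteq>{..<n}. card H = k \<and> (\<forall>e\<in>[H]\<^bsup>2\<^esup>. f e = 0)) \<or>
         (\<exists>H\<subseteq>{..<n}. card H = s \<and> (\<forall>e\<in>[H]\<^bsup>2\<^esup>. f e = 1)))"
    by (rule ccontr, rule notE[OF none], rule ballI, rule ccontr, erule notE, erule bexI[rotated])
  then obtain f where f: "f \<in> [{..<n}]\<^bsup>2\<^esup> \<rightarrow> {0, 1::nat}"
    and red: "\<not> (\<exists>H\<subseteq>{..<n}. card H = k \<and> (\<forall>e\<in>[H]\<^bsup>2\<^esup>. f e = 0))"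
    and blue: "\<not> (\<exists>H\<subseteq>{..<n}. card H = s \<and> (\<forall>e\<in>[H]\<^bsup>2\<^esup>. f e = 1))"
    unfolding de_Morgan_disj by (elim bexE conjE)
  have f0: "\<exists>e\<in>[H]\<^bsup>2\<^esup>. f e \<noteq> 0" if "H \<subseteq> {..<n}" "card H = k" for H
    using red that by blast
  have f1: "\<exists>e\<in>[H]\<^bsup>2\<^esup>. f e \<noteq> 1" if "H \<subseteq> {..<n}" "card H = s" for H
    using blue that by blast
  define c where "c x y = (f {x, y} = 0)" for x y
  have "card K < (if p then k else s)" if K: "K \<subseteq> {..<n}" "mono_clique c p K" for p K
  proof (rule ccontr)
    assume "\<not> ?thesis"
    then obtain H where H: "H \<subseteq> K" "card H = (if p then k else s)"
      by (metis not_less obtain_subset_with_card_n)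
    have "H \<subseteq> {..<n}" using H(1) K(1) by (rule subset_trans)
    then have "\<exists>e\<in>[H]\<^bsup>2\<^esup>. f e \<noteq> (if p then 0 else 1)"
      using f0[of H] f1[of H] H(2) by (cases p) simp_all
    then obtain e where e: "e \<in> [H]\<^bsup>2\<^esup>" "f e \<noteq> (if p then 0 else 1)" by blast
    obtain x y where xy: "e = {x, y}" "x \<in> H" "y \<in> H" "x \<noteq> y"
      using e(1) by (auto simp: nsets_def card_2_iff)
    have "e \<in> [{..<n}]\<^bsup>2\<^esup>" using e(1) H(1) K(1) by (auto simp: nsets_def)
    then have "f e \<in> {0, 1}" by (rule funcset_mem[OF f])
    moreover have "c x y = p" using mono_cliqueD[OF K(2)] xy H(1) by blast
    ultimately show False using e(2) xy(1) by (auto simp: c_def split: if_splits)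
  qed
  moreover have "c x y = c y x" for x y by (simp add: c_def insert_commute)
  ultimately show "\<exists>c. avoiding {..<n} c (\<lambda>p. if p then k else s)"
    unfolding avoiding_def by blast
next
  assume "\<exists>c. avoiding {..<n} c (\<lambda>p. if p then k else s)"
  then obtain c where av: "avoiding {..<n} c (\<lambda>p. if p then k else s)" by blast
  have sym: "c x y = c y x" for x y using av by (simp add: avoiding_def)
  have c: "card K < (if p then k else s)" if "K \<subseteq> {..<n}" "mono_clique c p K" for p K
    using av that unfolding avoiding_def by blast
  define f where "f e = (if \<exists>x y. e = {x, y} \<and> c x y then 0 else 1::nat)" for e
  have f: "f {x, y} = (if c x y then 0 else 1)" for x y
  proof -
    have "(\<exists>u z. {x, y} = {u, z} \<and> c u z) \<longleftrightarrow> c x y" by (metis doubleton_eq_iff sym)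
    then show ?thesis by (simp add: f_def)
  qed
  have clique: "mono_clique c p H" if "\<forall>e\<in>[H]\<^bsup>2\<^esup>. f e = (if p then 0 else 1)" for p H
    unfolding mono_clique_def
  proof (intro ballI impI)
    fix x y assume "x \<in> H" "y \<in> H" "x \<noteq> y"
    then have "{x, y} \<in> [H]\<^bsup>2\<^esup>" by (simp add: nsets_def)
    with that have "f {x, y} = (if p then 0 else 1)" by (rule bspec)
    then show "c x y = p" unfolding f by (simp split: if_splits)
  qed
  have f_in: "f \<in> [{..<n}]\<^bsup>2\<^esup> \<rightarrow> {0, 1}" by (rule funcsetI) (simp add: f_def)
  have no_red: "\<not> (\<exists>H\<subseteq>{..<n}. card H = k \<and> (\<forall>e\<in>[H]\<^bsup>2\<^esup>. f e = 0))"
  proof clarify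
    fix H assume "H \<subseteq> {..<n}" "k = card H" "\<forall>e\<in>[H]\<^bsup>2\<^esup>. f e = 0"
    then show False using clique[of H True] c[of H True] by simp
  qed
  have no_blue: "\<not> (\<exists>H\<subseteq>{..<n}. card H = s \<and> (\<forall>e\<in>[H]\<^bsup>2\<^esup>. f e = 1))"
  proof clarify
    fix H assume "H \<subseteq> {..<n}" "s = card H" "\<forall>e\<in>[H]\<^bsup>2\<^esup>. f e = 1"
    then show False using clique[of H False] c[of H False] by simp
  qed
  show "\<not> partn_lst {..<n} [k, s] 2"
  proof
    assume "partn_lst {..<n} [k, s] 2"
    from bspec[OF this[unfolded partn_lst_two_colours_iff] f_in] no_red no_blue show False
      by (elim disjE) (erule notE, assumption)+
  qed
qed

lemma avoiding_below_ramsey_number: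
  assumes "n < ramsey_number k s"
  shows "\<exists>c. avoiding {..<n} c (\<lambda>p. if p then k else s)"
  using assms not_less_Least unfolding ramsey_number_def not_partn_lst_iff_avoiding[symmetric] by blast

lemma avoiding_transfer:
  assumes "avoiding X c L" and "inj_on f Y" and "f ` Y \<subseteq> X"
  shows "avoiding Y (\<lambda>x y. c (f x) (f y)) L"
  unfolding avoiding_def
proof (intro conjI allI impI)
  show "c (f x) (f y) = c (f y) (f x)" for x y
    using assms(1) by (simp add: avoiding_def)
next
  fix p K assume K: "K \<subseteq> Y" "mono_clique (\<lambda>x y. c (f x) (f y)) p K"
  have inj: "inj_on f K" using assms(2) K(1) by (rule inj_on_subset)
  have "mono_clique c p (f ` K)" using K(2) by (auto simp: mono_clique_def)
  moreover have "f ` K \<subseteq> X" using K(1) assms(3) by blast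
  ultimately have "card (f ` K) < L p" using assms(1) unfolding avoiding_def by blast
  then show "card K < L p" by (simp add: card_image[OF inj])
qed

lemma card_less_ramsey_number:
  assumes "finite X" and "avoiding X c (\<lambda>p. if p then k else s)"
  shows "card X < ramsey_number k s"
proof (rule ccontr)
  let ?L = "\<lambda>p. if p then k else s"
  assume "\<not> card X < ramsey_number k s"
  then have le: "ramsey_number k s \<le> card X" by simp
  obtain f where "bij_betw f {..<card X} X"
    using ex_bij_betw_nat_finite[OF assms(1)] by (auto simp: atLeast0LessThan)
  then have f: "inj_on f {..<card X}" "f ` {..<card X} = X" by (auto simp: bij_betw_def)
  have "avoiding {..<ramsey_number k s} (\<lambda>x y. c (f x) (f y)) ?L"
    by (rule avoiding_transfer[OF assms(2)]) (use f le in \<open>auto intro: inj_on_subset\<close>)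
  then show False
    using partn_lst_ramsey_number not_partn_lst_iff_avoiding by blast
qed

section \<open>Critical colourings\<close>

text \<open>
  Otherwise \<open>z\<close> can be added as a twin of \<open>v\<close>, the edge between the twins getting colour \<open>p\<close>: the
  only new cliques that do not project injectively to \<open>X\<close> contain both twins, have colour \<open>p\<close>, and
  lose only one vertex in the projection.
\<close>

lemma critical_vertex_in_clique:
  assumes av: "avoiding X c L" and v: "v \<in> X" and z: "z \<notin> X" 
    and crit: "\<nexists>c'. avoiding (insert z X) c' L"
  shows "\<exists>K\<subseteq>X. mono_clique c p K \<and> v \<in> K \<and> L p \<le> Suc (card K)"
proof (rule ccontr)
  assume no: "\<not> ?thesis"
  define h where "h x = (if x = z then v else x)" for x
  define c' where "c' x y = (if h x = h y then p else c (h x) (h y))" for x y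
  have c: "c x y = c y x" "K \<subseteq> X \<Longrightarrow> mono_clique c q K \<Longrightarrow> card K < L q" for x y q K
    using av by (auto simp: avoiding_def)
  have "card K < L q" if K: "K \<subseteq> insert z X" "mono_clique c' q K" for q K
  proof (cases "z \<in> K \<and> v \<in> K")
    case False
    have inj: "inj_on h K" using False by (auto simp: inj_on_def h_def split: if_splits)
    have "mono_clique c q (h ` K)"
      unfolding mono_clique_def
    proof clarify
      fix x y assume xy: "x \<in> K" "y \<in> K" "h x \<noteq> h y"
      then have "c' x y = q" using mono_cliqueD[OF K(2), of x y] by blast
      then show "c (h x) (h y) = q" using xy(3) by (simp add: c'_def)
    qed
    moreover have "h ` K \<subseteq> X" using K(1) v by (auto simp: h_def)
    ultimately have "card (h ` K) < L q" by (rule c(2)[rotated])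
    then show ?thesis by (simp add: card_image[OF inj])
  next
    case True
    have zv: "z \<noteq> v" using v z by auto
    have "c' z v = q" using mono_cliqueD[OF K(2)] True zv by blast
    then have q: "q = p" by (simp add: c'_def h_def)
    have sub: "K - {z} \<subseteq> X" using K(1) by auto
    have "mono_clique c p (K - {z})"
      unfolding mono_clique_def
    proof (intro ballI impI)
      fix x y assume xy: "x \<in> K - {z}" "y \<in> K - {z}" "x \<noteq> y"
      then have "c' x y = p" using mono_cliqueD[OF K(2), of x y] q by blast
      moreover have "h x = x" "h y = y" using xy by (auto simp: h_def)
      ultimately show "c x y = p" using xy(3) by (simp add: c'_def)
    qed
    then have "Suc (card (K - {z})) < L p" using no sub True zv by (metis Diff_iff not_less singletonD)
    then show ?thesis using True q by (cases "finite K") (auto simp: card_Diff_singleton_if)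
  qed
  moreover have "c' x y = c' y x" for x y by (simp add: c'_def c(1))
  ultimately have "avoiding (insert z X) c' L" by (auto simp: avoiding_def)
  then show False using crit by blast
qed

section \<open>The extended colouring\<close>

datatype 'a vertex = Old 'a | Pent nat | Copy bool nat | Join bool nat

text \<open>
  The map \<open>x \<mapsto> 2x + 2\<close> modulo 5 carries the blue edges of the pentagon to the red ones. Hence in
  the numbering by \<open>pent_label p\<close> the edges of colour \<open>p\<close> join consecutive vertices for either \<open>p\<close>,
  and the colouring can be described once for both colours. Among the maps with this property,
  this one is chosen to make \<open>across\<close> below come out.
\<close>

definition pent_label :: "bool \<Rightarrow> nat \<Rightarrow> nat" where
  "pent_label p x = (if p then x else (2 * x + 2) mod 5)"

definition cyc5 :: "nat \<Rightarrow> nat \<Rightarrow> bool" where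
  "cyc5 x y \<longleftrightarrow> y = Suc x mod 5 \<or> x = Suc y mod 5"

lemma less_5_cases: "(x::nat) < 5 \<Longrightarrow> x = 0 \<or> x = 1 \<or> x = 2 \<or> x = 3 \<or> x = 4"
  by auto

lemma cyc5_pent_label:
  assumes "x < 5" "y < 5" "x \<noteq> y"
  shows "cyc5 (pent_label p x) (pent_label p y) \<longleftrightarrow> cyc5 x y = p"
  using less_5_cases[OF assms(1)] less_5_cases[OF assms(2)] assms(3)
  by (elim disjE; cases p; simp add: cyc5_def pent_label_def)

lemma pent_label_less: "x < 5 \<Longrightarrow> pent_label p x < 5"
  by (simp add: pent_label_def)

lemma pent_label_inj: "x < 5 \<Longrightarrow> y < 5 \<Longrightarrow> pent_label p x = pent_label p y \<longleftrightarrow> x = y"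
  by (drule less_5_cases, drule less_5_cases, elim disjE; cases p; simp add: pent_label_def)

lemma cyc5_triangle_free:
  "x < 5 \<Longrightarrow> y < 5 \<Longrightarrow> z < 5 \<Longrightarrow> cyc5 x y \<Longrightarrow> cyc5 y z \<Longrightarrow> cyc5 x z \<Longrightarrow> False"
  by (drule less_5_cases, drule less_5_cases, drule less_5_cases, elim disjE; simp add: cyc5_def)

text \<open>
  The labels of the pentagon vertices that \<open>Join p j\<close> sees in the colour \<open>\<not> p\<close>, with \<open>l = L p\<close>. Each set
  consists of at most two consecutive labels: two pentagon vertices joined in colour \<open>\<not> p\<close> together
  with \<open>Join p j\<close> must not form a \<open>(\<not> p)\<close>-triangle, since such a triangle could be extended by
  \<open>L (\<not> p) - 2\<close> vertices of \<open>G\<close>. Every label is covered, because each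
  pentagon vertex in a \<open>p\<close>-clique has to exclude some of the \<open>Join p j\<close> from it.
\<close>

definition pent_off :: "nat \<Rightarrow> nat \<Rightarrow> nat set" where
  "pent_off l j = (if j < 2 then {2, 3} else if j + 2 < l then {1}
     else if j + 2 = l then {0, 1} else {3, 4})"

text \<open>
  The vertices \<open>w p j\<close> with \<open>j + 2 < L p\<close> form with \<open>v\<close> a clique of colour \<open>p\<close> and
  size \<open>L p - 1\<close>.
\<close>

locale critical_colouring =
  fixes X :: "'a set" and c :: "'a \<Rightarrow> 'a \<Rightarrow> bool" and L :: "bool \<Rightarrow> nat" and v :: 'a
    and w :: "bool \<Rightarrow> nat \<Rightarrow> 'a"
  assumes finX: "finite X"
    and avoid: "avoiding X c L"
    and L5: "5 \<le> L p"
    and v_in: "v \<in> X"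
    and w_in: "j + 2 < L p \<Longrightarrow> w p j \<in> X"
    and w_neq_v: "j + 2 < L p \<Longrightarrow> w p j \<noteq> v"
    and w_inj: "j + 2 < L p \<Longrightarrow> l + 2 < L p \<Longrightarrow> w p j = w p l \<Longrightarrow> j = l"
    and w_v: "j + 2 < L p \<Longrightarrow> c (w p j) v = p"
    and w_w: "j + 2 < L p \<Longrightarrow> l + 2 < L p \<Longrightarrow> j \<noteq> l \<Longrightarrow> c (w p j) (w p l) = p"
begin

lemma c_sym: "c x y = c y x"
  using avoid by (simp add: avoiding_def)

lemma card_clique: "K \<subseteq> X \<Longrightarrow> mono_clique c p K \<Longrightarrow> card K < L p"
  using avoid by (simp add: avoiding_def)

text \<open>
  The colour of the edge between \<open>Join True j\<close> and \<open>Join False i\<close>. What this pattern has to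
  achieve is the lemma \<open>across\<close>.
\<close>

definition join_col :: "nat \<Rightarrow> nat \<Rightarrow> bool" where
  "join_col j i \<longleftrightarrow> \<not> ((L False \<le> i + 2 \<and> j < 2) \<or> (j + 1 = L True \<and> i + 1 \<noteq> L False))"

text \<open>
  In general, edges at a twin are coloured like the edges at its original, and \<open>Join p j\<close> is joined
  to the vertices \<open>Copy p l\<close> in colour \<open>p\<close> and to all other vertices outside the joins in colour
  \<open>\<not> p\<close>. The opposite colour is given to the edge between \<open>Copy p 0\<close> and \<open>Copy p 1\<close>, to the edges from
  \<open>Copy p j\<close> with \<open>j \<ge> 2\<close> to the pentagon vertex of label 0, and to the edges from \<open>Join p j\<close> to \<open>w p j\<close>, to
  \<open>Copy p j\<close> and to the pentagon vertices outside \<open>pent_off\<close>. The equations after the first ten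
  repeat earlier ones with the arguments exchanged.

  The edge from \<open>Join p j\<close> to \<open>w p j\<close> is necessary since
  \<open>w p j\<close>, \<open>Copy p j\<close> and \<open>Join p j\<close> would otherwise form a \<open>(\<not> p)\<close>-triangle that could be extended
  by a large clique of \<open>G\<close>.
\<close>

fun col :: "'a vertex \<Rightarrow> 'a vertex \<Rightarrow> bool" where
  "col (Old x) (Old y) = c x y"
| "col (Old x) (Pent y) = c x v"
| "col (Pent x) (Pent y) = cyc5 x y"
| "col (Copy p j) (Old x) = (if x = w p j then \<not> p else c (w p j) x)"
| "col (Copy p j) (Pent x) = (if 2 \<le> j \<and> pent_label p x = 0 then \<not> p else p)"
| "col (Copy p j) (Copy q l) = (if p \<noteq> q then c (w p j) (w q l)
     else if j \<noteq> l \<and> j < 2 \<and> l < 2 then \<not> p else p)"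
| "col (Join p j) (Old x) = (if j + 2 < L p \<and> x = w p j then p else \<not> p)"
| "col (Join p j) (Pent x) = (if pent_label p x \<in> pent_off (L p) j then \<not> p else p)"
| "col (Join p j) (Copy q l) = (if p = q \<and> j \<noteq> l then p else \<not> p)"
| "col (Join p j) (Join q l) = (if p = q then p else if p then join_col j l else join_col l j)"
| "col (Pent y) (Old x) = c x v"
| "col (Old x) (Copy p j) = (if x = w p j then \<not> p else c (w p j) x)"
| "col (Pent x) (Copy p j) = (if 2 \<le> j \<and> pent_label p x = 0 then \<not> p else p)"
| "col (Old x) (Join p j) = (if j + 2 < L p \<and> x = w p j then p else \<not> p)"
| "col (Pent x) (Join p j) = (if pent_label p x \<in> pent_off (L p) j then \<not> p else p)"
| "col (Copy q l) (Join p j) = (if p = q \<and> j \<noteq> l then p else \<not> p)"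

lemma col_sym: "col x y = col y x"
  by (cases x; cases y) (auto simp: cyc5_def c_sym)

definition verts :: "'a vertex set" where
  "verts = Old ` (X - {v}) \<union> Pent ` {..<5} \<union> {Copy p j |p j. j + 2 < L p} \<union> {Join p j |p j. j < L p}"

lemma verts_simps [simp]:
  "Old x \<in> verts \<longleftrightarrow> x \<in> X \<and> x \<noteq> v"
  "Pent y \<in> verts \<longleftrightarrow> y < 5"
  "Copy p j \<in> verts \<longleftrightarrow> j + 2 < L p"
  "Join p j \<in> verts \<longleftrightarrow> j < L p"
  by (auto simp: verts_def)

lemma
  shows finite_verts: "finite verts"
    and card_verts: "card verts = card X + 2 * L True + 2 * L False"
proof -
  have split: "verts = Old ` (X - {v}) \<union> (Pent ` {..<5} \<union> (Copy True ` {..<L True - 2} \<union> 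
     (Copy False ` {..<L False - 2} \<union> (Join True ` {..<L True} \<union> Join False ` {..<L False}))))" (is "_ = ?U")
  proof (rule set_eqI)
    show "x \<in> verts \<longleftrightarrow> x \<in> ?U" for x
    proof (cases x)
      case (Copy p j) then show ?thesis by (cases p) auto
    next
      case (Join p j) then show ?thesis by (cases p) auto
    qed auto
  qed
  show "finite verts" unfolding split using finX by simp
  have inj: "inj Old" "inj Pent" "inj (Copy p)" "inj (Join p)" for p
    by (simp_all add: inj_on_def)
  have "card verts = card (X - {v}) + (5 + ((L True - 2) + ((L False - 2) + (L True + L False))))"
    unfolding split
    by (subst card_Un_disjoint, use finX in simp, simp, fastforce)+
       (simp add: card_image inj[THEN inj_on_subset])
  moreover have "card X = Suc (card (X - {v}))" using finX v_in by (metis card.remove)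
  ultimately show "card verts = card X + 2 * L True + 2 * L False"
    using L5[of True] L5[of False] by simp
qed

section \<open>Cliques that avoid the joins of their own colour\<close>

text \<open>
  The value at the vertices \<open>Join p j\<close>, which are twins of no vertex, is arbitrary.
\<close>

fun proj :: "'a vertex \<Rightarrow> 'a" where
  "proj (Old x) = x"
| "proj (Pent y) = v"
| "proj (Copy p j) = w p j"
| "proj (Join p j) = v"

definition faithful :: "bool \<Rightarrow> 'a vertex \<Rightarrow> 'a vertex \<Rightarrow> bool" where
  "faithful p x y \<longleftrightarrow> proj x \<noteq> proj y \<and> c (proj x) (proj y) = p"

text \<open>
  Up to order, every edge of colour \<open>p\<close> that is not faithful is of one of these kinds
  (\<open>faithful_or_gain\<close>), so only they can make a \<open>p\<close>-clique larger than the cliques of \<open>X\<close>.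
\<close>

inductive gain :: "bool \<Rightarrow> 'a vertex \<Rightarrow> 'a vertex \<Rightarrow> bool" for p where
  "a \<noteq> b \<Longrightarrow> gain p (Pent a) (Pent b)"
| "gain p (Copy (\<not> p) i) (Old (w (\<not> p) i))"
| "i < 2 \<Longrightarrow> l < 2 \<Longrightarrow> i \<noteq> l \<Longrightarrow> gain p (Copy (\<not> p) i) (Copy (\<not> p) l)"
| "2 \<le> i \<Longrightarrow> pent_label (\<not> p) a = 0 \<Longrightarrow> gain p (Copy (\<not> p) i) (Pent a)"

lemma w_neq_w_not: "i + 2 < L p \<Longrightarrow> l + 2 < L q \<Longrightarrow> p \<noteq> q \<Longrightarrow> w p i \<noteq> w q l"
  using w_v[of i p] w_v[of l q] by auto

lemma faithful_or_gain:
  assumes "x \<in> verts" "y \<in> verts" "x \<noteq> y" "col x y = p" "\<And>q j. x \<noteq> Join q j" "\<And>q j. y \<noteq> Join q j"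
  shows "faithful p x y \<or> gain p x y \<or> gain p y x"
proof (cases x)
  case x: (Old a)
  show ?thesis
  proof (cases y)
    case (Copy q j)
    show ?thesis
    proof (cases "a = w q j")
      case True
      then have "q = (\<not> p)" using assms(4) x Copy by auto
      then have "gain p y x" using x Copy True by (simp add: gain.intros)
      then show ?thesis by simp
    next
      case False
      then show ?thesis using assms(4) x Copy by (auto simp: faithful_def c_sym)
    qed
  qed (use assms x in \<open>auto simp: faithful_def\<close>)
next
  case x: (Pent a)
  show ?thesis
  proof (cases y)
    case (Pent b) then show ?thesis using x assms(3) by (simp add: gain.intros)
  next
    case (Copy q j)
    show ?thesis
    proof (cases "q = p")
      case True
      then show ?thesis using assms x Copy w_v[of j q] w_neq_v[of j q] by (auto simp: faithful_def c_sym)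
    next
      case False
      then have "q = (\<not> p)" "2 \<le> j" "pent_label q a = 0" using assms(4) x Copy by (auto split: if_splits)
      then have "gain p y x" using x Copy by (auto intro: gain.intros)
      then show ?thesis by simp
    qed
  qed (use assms x in \<open>auto simp: faithful_def c_sym\<close>)
next
  case x: (Copy q j)
  show ?thesis
  proof (cases y)
    case (Old a)
    show ?thesis
    proof (cases "a = w q j")
      case True
      then have "q = (\<not> p)" using assms(4) x Old by auto
      then have "gain p x y" using x Old True by (simp add: gain.intros)
      then show ?thesis by simp
    next
      case False
      then show ?thesis using assms(4) x Old by (auto simp: faithful_def c_sym)
    qed
  next
    case (Pent a)
    show ?thesis
    proof (cases "q = p")
      case True
      then show ?thesis using assms x Pent w_v[of j q] w_neq_v[of j q] by (auto simp: faithful_def c_sym)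
    next
      case False
      then have "q = (\<not> p)" "2 \<le> j" "pent_label q a = 0" using assms(4) x Pent by (auto split: if_splits)
      then have "gain p x y" using x Pent by (auto intro: gain.intros)
      then show ?thesis by simp
    qed
  next
    case y: (Copy r l)
    consider "q \<noteq> r" | "q = r" "q = p" | "q = r" "q = (\<not> p)" by auto
    then show ?thesis
    proof cases
      case 1
      then show ?thesis using assms x y w_neq_w_not[of j q l r] by (auto simp: faithful_def)
    next
      case 2
      then have "j \<noteq> l" using assms(3) x y by auto
      then show ?thesis using 2 assms x y w_w[of j q l] w_inj[of j q l] by (auto simp: faithful_def)
    next
      case 3
      then have "j \<noteq> l" "j < 2" "l < 2" using assms(4) x y by (auto split: if_splits)
      then have "gain p x y" using x y 3 by (auto intro: gain.intros)
      then show ?thesis by simp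
    qed
  qed (use assms in auto)
qed (use assms in auto)

lemma card_faithful_clique:
  assumes "H \<subseteq> verts" "\<And>q j. Join q j \<notin> H"
    and "\<And>x y. x \<in> H \<Longrightarrow> y \<in> H \<Longrightarrow> x \<noteq> y \<Longrightarrow> faithful p x y"
  shows "card H < L p"
proof -
  have inj: "inj_on proj H" using assms(3) by (fastforce simp: inj_on_def faithful_def)
  have "proj ` H \<subseteq> X"
  proof
    fix z assume "z \<in> proj ` H"
    then obtain x where x: "x \<in> H" "z = proj x" by blast
    then have "x \<in> verts" using assms(1) by blast
    then show "z \<in> X" using x(2) v_in w_in by (cases x) auto
  qed
  moreover have "mono_clique c p (proj ` H)"
    unfolding mono_clique_def
  proof clarify
    fix x y assume "x \<in> H" "y \<in> H" "proj x \<noteq> proj y"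
    then show "c (proj x) (proj y) = p" using assms(3)[of x y] by (auto simp: faithful_def)
  qed
  ultimately have "card (proj ` H) < L p" by (rule card_clique)
  then show ?thesis by (simp add: card_image[OF inj])
qed

text \<open>
  A vertex \<open>Join (\<not> p) i\<close> in a \<open>p\<close>-clique has to leave an index unused, and another one than a
  pentagon vertex of the clique does. There are two ways. Being joined to \<open>Join p 0\<close> and \<open>Join p 1\<close> in the colour
  \<open>\<not> p\<close> excludes index 0 or 1, because the edge between \<open>Copy p 0\<close> and \<open>Copy p 1\<close> also has
  that colour; this collides only with the pentagon vertex of label 2, which excludes one of the
  same two indices, and then the index \<open>L p - 1\<close> has to help out. Being joined to the last \<open>Join p (L p - 1)\<close> in the colour \<open>\<not> p\<close> excludes the
  index \<open>L p - 1\<close>; label 4 is then ruled out since it excludes the same index, and label 1 because of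
  the cliques treated in \<open>card_clique_join_old\<close>.
\<close>

lemma across:
  assumes "i < L (\<not> p)"
  shows "((\<forall>j<2. col (Join (\<not> p) i) (Join p j) = (\<not> p)) \<and>
      (col (Join (\<not> p) i) (Join p (L p - 1)) = (\<not> p) \<or>
        (\<forall>x<5. pent_label p x = 2 \<longrightarrow> col (Join (\<not> p) i) (Pent x) = (\<not> p)))) \<or>
    (col (Join (\<not> p) i) (Join p (L p - 1)) = (\<not> p) \<and>
      (\<forall>x<5. pent_label p x \<in> {1, 4} \<longrightarrow> col (Join (\<not> p) i) (Pent x) = (\<not> p)))"
proof -
  have L: "5 \<le> L True" "5 \<le> L False" by (rule L5)+
  have all5: "(\<forall>x<5. P x) \<longleftrightarrow> P 0 \<and> P 1 \<and> P 2 \<and> P 3 \<and> P (4::nat)" for P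
    using less_5_cases by fastforce
  consider "i < 2" | "2 \<le> i" "i + 2 < L (\<not> p)" | "i + 2 = L (\<not> p)" | "i + 1 = L (\<not> p)"
    using assms by linarith
  then show ?thesis
    using L by cases (cases p; simp add: all5 join_col_def pent_off_def pent_label_def; linarith?)+
qed

context
  fixes p :: bool and K :: "'a vertex set"
  assumes K_verts: "K \<subseteq> verts" and K_clique: "mono_clique col p K"
begin

lemma adj: "x \<in> K \<Longrightarrow> y \<in> K \<Longrightarrow> x \<noteq> y \<Longrightarrow> col x y = p"
  using K_clique by (auto simp: mono_clique_def)

lemma in_verts: "x \<in> K \<Longrightarrow> x \<in> verts"
  using K_verts by auto

lemma finite_K: "finite K"
  using K_verts finite_verts finite_subset by blast

lemma pent_adj:
  assumes "Pent a \<in> K" "Pent b \<in> K" "a \<noteq> b"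
  shows "cyc5 (pent_label p a) (pent_label p b)"
  using assms adj[of "Pent a" "Pent b"] in_verts[of "Pent a"] in_verts[of "Pent b"]
  by (simp add: cyc5_pent_label)

lemma no_three_pents:
  assumes "Pent x \<in> K" "Pent y \<in> K" "Pent z \<in> K" "x \<noteq> y" "y \<noteq> z" "x \<noteq> z"
  shows False
  using assms cyc5_triangle_free[of "pent_label p x" "pent_label p y" "pent_label p z"]
    pent_adj[of x y] pent_adj[of y z] pent_adj[of x z] in_verts[of "Pent x"] in_verts[of "Pent y"]
    in_verts[of "Pent z"] by (simp add: pent_label_less)

lemma other_join_pent:
  assumes "Join (\<not> p) i \<in> K" "Pent a \<in> K"
  shows "pent_label (\<not> p) a \<in> pent_off (L (\<not> p)) i"
  using adj[OF assms] by (auto split: if_splits)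

text \<open>
  The labels in \<open>pent_off (L (\<not> p)) i\<close> are consecutive in the numbering for \<open>\<not> p\<close>, so the two
  vertices would be joined in the colour \<open>\<not> p\<close>.
\<close>

lemma other_join_one_pent:
  assumes "Join (\<not> p) i \<in> K" "Pent a \<in> K" "Pent b \<in> K"
  shows "a = b"
proof (rule ccontr)
  assume ab: "a \<noteq> b"
  have lt: "a < 5" "b < 5" using in_verts[of "Pent a"] in_verts[of "Pent b"] assms by simp_all
  have neq: "pent_label (\<not> p) a \<noteq> pent_label (\<not> p) b" using ab pent_label_inj[OF lt] by simp
  have "cyc5 (pent_label (\<not> p) a) (pent_label (\<not> p) b)"
    using other_join_pent[OF assms(1,2)] other_join_pent[OF assms(1,3)] neq
    by (auto simp: pent_off_def cyc5_def split: if_splits)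
  then have "cyc5 a b = (\<not> p)" using cyc5_pent_label[OF lt ab] by simp
  then show False using adj[OF assms(2,3)] ab by simp
qed

lemma other_join_unique:
  assumes "Join (\<not> p) i \<in> K" "Join (\<not> p) l \<in> K"
  shows "i = l"
  using adj[OF assms] by auto

text \<open>
  All unfaithful edges inside \<open>K\<close> share a vertex \<open>t\<close>. If \<open>K\<close> contains some \<open>Join (\<not> p) i\<close>, that vertex
  leaves no unfaithful edge at all and is itself taken as \<open>t\<close>. Otherwise \<open>t\<close> is some
  \<open>Copy (\<not> p) i\<close>, if there is one in \<open>K\<close>, and else a pentagon vertex.
\<close>

lemma gain_centre:
  assumes no_join: "\<And>j. Join p j \<notin> K"
  shows "\<exists>t. (\<forall>q j. Join q j \<notin> K - {t}) \<and> (\<forall>x\<in>K - {t}. \<forall>y\<in>K - {t}. \<not> gain p x y)"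
proof -
  consider i where "Join (\<not> p) i \<in> K"
    | i where "\<forall>i. Join (\<not> p) i \<notin> K" "2 \<le> i" "Copy (\<not> p) i \<in> K"
    | i where "\<forall>i. Join (\<not> p) i \<notin> K" "\<forall>i\<ge>2. Copy (\<not> p) i \<notin> K" "i < 2" "Copy (\<not> p) i \<in> K"
    | "\<forall>i. Join (\<not> p) i \<notin> K" "\<forall>i. Copy (\<not> p) i \<notin> K"
    by (metis not_less)
  then show ?thesis
  proof cases
    case (1 i)
    let ?t = "Join (\<not> p) i"
    have copy: "l = i \<and> i + 2 < L (\<not> p)" if "Copy (\<not> p) l \<in> K" for l
      using adj[OF 1 that] in_verts[OF that] by (auto split: if_splits)
    have "\<not> gain p x y" if "x \<in> K - {?t}" "y \<in> K - {?t}" for x y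
    proof
      assume "gain p x y"
      then show False
      proof cases
        case (1 a b)
        then show False using other_join_one_pent[OF \<open>?t \<in> K\<close>] that by blast
      next
        case (2 l)
        then have "l = i" "i + 2 < L (\<not> p)" using copy that by auto
        then show False using adj[OF \<open>?t \<in> K\<close>, of y] 2 that by auto
      next
        case (3 l m)
        then show False using copy that by blast
      next
        case (4 l a)
        then have "l = i" "i + 2 < L (\<not> p)" using copy that by auto
        then show False using other_join_pent[OF \<open>?t \<in> K\<close>, of a] 4 that by (simp add: pent_off_def)
      qed
    qed
    moreover have "Join q j \<notin> K - {?t}" for q j
      using no_join[of j] other_join_unique[OF 1, of j] by (cases "q = p") auto
    ultimately show ?thesis by blast
  next
    case (2 i)
    let ?t = "Copy (\<not> p) i"
    have pent: "pent_label (\<not> p) a = 0" if "Pent a \<in> K" for a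
      using adj[OF \<open>?t \<in> K\<close> that] by (auto split: if_splits)
    have copy: "l = i" if "Copy (\<not> p) l \<in> K" for l
      using adj[OF \<open>?t \<in> K\<close> that] \<open>2 \<le> i\<close> by (auto split: if_splits)
    have "\<not> gain p x y" if "x \<in> K - {?t}" "y \<in> K - {?t}" for x y
    proof
      assume "gain p x y"
      then show False
      proof cases
        case (1 a b)
        then show False using pent[of a] pent[of b] that pent_label_inj[of a b "\<not> p"] in_verts[of x] in_verts[of y]
          by auto
      qed (use copy that in blast)+
    qed
    moreover have "Join q j \<notin> K" for q j
      using no_join[of j] 2(1) by (cases "q = p") auto
    ultimately show ?thesis by blast
  next
    case (3 i)
    let ?t = "Copy (\<not> p) i"
    have pent: "Pent a \<notin> K" for a
      using adj[OF \<open>?t \<in> K\<close>, of "Pent a"] \<open>i < 2\<close> by auto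
    have "\<not> gain p x y" if "x \<in> K - {?t}" "y \<in> K - {?t}" for x y
    proof
      assume "gain p x y"
      then show False
      proof cases
        case (2 l)
        then have l: "l \<noteq> i" "l + 2 < L (\<not> p)" "i + 2 < L (\<not> p)"
          using that in_verts[of x] in_verts[OF \<open>?t \<in> K\<close>] by auto
        then have "w (\<not> p) l \<noteq> w (\<not> p) i" "c (w (\<not> p) i) (w (\<not> p) l) = (\<not> p)"
          using w_inj[of l "\<not> p" i] w_w[of i "\<not> p" l] by auto
        then show False using adj[OF \<open>?t \<in> K\<close>, of y] 2 that by auto
      next
        case (3 l m)
        then show False using \<open>i < 2\<close> that by (auto simp: less_2_cases_iff)
      qed (use pent 3 that in auto)
    qed
    moreover have "Join q j \<notin> K" for q j
      using no_join[of j] 3(1) by (cases "q = p") auto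
    ultimately show ?thesis by blast
  next
    case 4
    have "\<exists>t. \<forall>a b. a \<noteq> b \<longrightarrow> Pent a \<in> K - {t} \<longrightarrow> Pent b \<notin> K - {t}"
    proof (cases "\<exists>a. Pent a \<in> K")
      case True
      then obtain a where "Pent a \<in> K" by blast
      then have "\<forall>b d. b \<noteq> d \<longrightarrow> Pent b \<in> K - {Pent a} \<longrightarrow> Pent d \<notin> K - {Pent a}"
        using no_three_pents[of a] by blast
      then show ?thesis by blast
    qed blast
    then obtain t where t: "\<And>a b. a \<noteq> b \<Longrightarrow> Pent a \<in> K - {t} \<Longrightarrow> Pent b \<notin> K - {t}" by blast
    have "\<not> gain p x y" if "x \<in> K - {t}" "y \<in> K - {t}" for x y
    proof
      assume "gain p x y"
      then show False by cases (use t 4 that in blast)+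
    qed
    moreover have "Join q j \<notin> K" for q j
      using no_join[of j] 4(1) by (cases "q = p") auto
    ultimately show ?thesis by blast
  qed
qed

lemma card_clique_without_join:
  assumes "\<And>j. Join p j \<notin> K"
  shows "card K \<le> L p"
proof -
  obtain t where t: "\<And>q j. Join q j \<notin> K - {t}" "\<And>x y. x \<in> K - {t} \<Longrightarrow> y \<in> K - {t} \<Longrightarrow> \<not> gain p x y"
    using gain_centre[OF assms] by blast
  have "card (K - {t}) < L p"
  proof (rule card_faithful_clique)
    fix x y assume xy: "x \<in> K - {t}" "y \<in> K - {t}" "x \<noteq> y"
    have "faithful p x y \<or> gain p x y \<or> gain p y x"
      by (rule faithful_or_gain) (use xy in_verts adj t(1) in \<open>blast+\<close>)
    then show "faithful p x y" using t(2) xy by blast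
  qed (use K_verts t(1) in auto)
  then show ?thesis using finite_K by (simp add: card_Diff_singleton_if split: if_splits)
qed

section \<open>Cliques through a join of their own colour\<close>

definition used :: "nat set" where
  "used = {j. Copy p j \<in> K \<or> Join p j \<in> K}"

text \<open>The vertices of the clique that have to be paid for by unused indices.\<close>

definition rest :: "'a vertex set" where
  "rest = {x \<in> K. (\<exists>a. x = Pent a) \<or> (\<exists>i. x = Join (\<not> p) i)}"

lemma rest_pair:
  assumes "t \<in> rest" "u \<in> rest" "t \<noteq> u"
  obtains a b where "a \<noteq> b" "Pent a \<in> K" "Pent b \<in> K"
  | a i where "Pent a \<in> K" "Join (\<not> p) i \<in> K"
  using assms other_join_unique unfolding rest_def by blast

lemma card_rest_le_2: "card rest \<le> 2"
proof (rule ccontr)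
  assume "\<not> ?thesis"
  then obtain T where T: "T \<subseteq> rest" "card T = 3"
    by (metis Suc_leI not_le numeral_3_eq_3 numeral_2_eq_2 obtain_subset_with_card_n)
  then obtain x y z where xyz: "x \<in> rest" "y \<in> rest" "z \<in> rest" "x \<noteq> y" "x \<noteq> z" "y \<noteq> z"
    by (auto simp: card_3_iff)
  show False
  proof (cases "\<exists>i. Join (\<not> p) i \<in> K")
    case True
    then obtain i where i: "Join (\<not> p) i \<in> K" by blast
    show False using xyz other_join_unique[OF i] other_join_one_pent[OF i] unfolding rest_def by blast
  next
    case False
    then show False using xyz no_three_pents unfolding rest_def by blast
  qed
qed

lemma copies_0_1: "Copy p 0 \<in> K \<Longrightarrow> Copy p 1 \<notin> K"
  using adj[of "Copy p 0" "Copy p 1"] by auto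

lemma join_pent:
  assumes "Join p j \<in> K" "Pent a \<in> K"
  shows "pent_label p a \<notin> pent_off (L p) j"
  using adj[OF assms] by (auto split: if_splits)

text \<open>
  The following lemmas list the indices that a pentagon vertex leaves unused, by its label: the
  last two indices belong to no \<open>Copy p j\<close> and are lost as soon as \<open>Join p j\<close> is excluded, and of the
  indices 0 and 1 only one can be used by a copy.
\<close>

lemma unused_label_0_1:
  assumes "Pent a \<in> K" "pent_label p a = 0 \<or> pent_label p a = 1"
  shows "L p - 2 \<notin> used"
proof -
  have "Copy p (L p - 2) \<notin> K" using in_verts[of "Copy p (L p - 2)"] by auto
  moreover have "pent_off (L p) (L p - 2) = {0, 1}" using L5[of p] by (auto simp: pent_off_def)
  then have "Join p (L p - 2) \<notin> K" using join_pent[OF _ assms(1)] assms(2) by blast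
  ultimately show ?thesis by (simp add: used_def)
qed

lemma unused_label_3_4:
  assumes "Pent a \<in> K" "pent_label p a = 3 \<or> pent_label p a = 4"
  shows "L p - 1 \<notin> used"
proof -
  have "Copy p (L p - 1) \<notin> K" using in_verts[of "Copy p (L p - 1)"] by auto
  moreover have "pent_off (L p) (L p - 1) = {3, 4}" using L5[of p] by (auto simp: pent_off_def)
  then have "Join p (L p - 1) \<notin> K" using join_pent[OF _ assms(1)] assms(2) by blast
  ultimately show ?thesis by (simp add: used_def)
qed

lemma unused_label_2_3:
  assumes "Pent a \<in> K" "pent_label p a = 2 \<or> pent_label p a = 3"
  shows "0 \<notin> used \<or> 1 \<notin> used"
proof -
  have "pent_off (L p) 0 = {2, 3}" "pent_off (L p) 1 = {2, 3}" by (simp_all add: pent_off_def)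
  then have "Join p 0 \<notin> K" "Join p 1 \<notin> K" using join_pent[OF _ assms(1)] assms(2) by blast+
  then show ?thesis using copies_0_1 by (auto simp: used_def)
qed

lemma copy_label_0:
  assumes "Pent a \<in> K" "pent_label p a = 0"
  shows "Copy p 2 \<notin> K"
  using adj[of "Copy p 2", OF _ assms(1)] assms(2) by auto

lemma unused_labels_0_1:
  assumes "Pent a \<in> K" "pent_label p a = 0" "Pent b \<in> K" "pent_label p b = 1"
  shows "2 \<notin> used"
proof -
  have "pent_off (L p) 2 = {1}" using L5[of p] by (simp add: pent_off_def)
  then have "Join p 2 \<notin> K" using join_pent[OF _ assms(3)] assms(4) by blast
  then show ?thesis using copy_label_0[OF assms(1,2)] by (simp add: used_def)
qed

lemma label_cases:
  assumes "Pent a \<in> K"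
  obtains "pent_label p a = 0" | "pent_label p a = 1" | "pent_label p a = 2" | "pent_label p a = 3"
    | "pent_label p a = 4"
  using less_5_cases[OF pent_label_less, of a p] in_verts[OF assms] by auto

text \<open>The two alternatives of \<open>across\<close>, stated for the vertices present in the clique.\<close>

lemma other_join_cases:
  assumes "Join (\<not> p) i \<in> K"
  obtains "\<And>j. j < 2 \<Longrightarrow> Join p j \<notin> K"
      "L p - 1 \<notin> used \<or> (\<forall>a. Pent a \<in> K \<longrightarrow> pent_label p a \<noteq> 2)"
  | "L p - 1 \<notin> used" "\<And>a. Pent a \<in> K \<Longrightarrow> pent_label p a \<noteq> 1 \<and> pent_label p a \<noteq> 4"
proof -
  have top: "Copy p (L p - 1) \<notin> K" using in_verts[of "Copy p (L p - 1)"] by auto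
  have flip: "x \<notin> K" if "col (Join (\<not> p) i) x = (\<not> p)" "x \<noteq> Join (\<not> p) i" for x
    using adj[OF assms, of x] that by auto
  have "i < L (\<not> p)" using in_verts[OF assms] by simp
  from across[OF this] show thesis
  proof (elim disjE conjE)
    assume "\<forall>j<2. col (Join (\<not> p) i) (Join p j) = (\<not> p)"
    then have low: "Join p j \<notin> K" if "j < 2" for j using flip that by blast
    {
      assume "col (Join (\<not> p) i) (Join p (L p - 1)) = (\<not> p)"
      then have "Join p (L p - 1) \<notin> K" using flip by blast
      then show thesis using that(1) low top by (simp add: used_def)
    next
      assume "\<forall>x<5. pent_label p x = 2 \<longrightarrow> col (Join (\<not> p) i) (Pent x) = (\<not> p)"
      then have "pent_label p a \<noteq> 2" if "Pent a \<in> K" for a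
        using flip[of "Pent a"] in_verts[OF that] that by auto
      then show thesis using that(1) low by blast
    }
  next
    assume "col (Join (\<not> p) i) (Join p (L p - 1)) = (\<not> p)"
    then have "Join p (L p - 1) \<notin> K" using flip by blast
    then have "L p - 1 \<notin> used" using top by (simp add: used_def)
    moreover assume "\<forall>x<5. pent_label p x \<in> {1, 4} \<longrightarrow> col (Join (\<not> p) i) (Pent x) = (\<not> p)"
    then have "pent_label p a \<noteq> 1 \<and> pent_label p a \<noteq> 4" if "Pent a \<in> K" for a
      using flip[of "Pent a"] in_verts[OF that] that by auto
    ultimately show thesis using that(2) by blast
  qed
qed

lemma used_less: "j \<in> used \<Longrightarrow> j < L p"
  using in_verts[of "Copy p j"] in_verts[of "Join p j"] by (auto simp: used_def)

lemma card_used_le: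
  assumes "j < L p" "j \<notin> used"
  shows "card used \<le> L p - 1"
proof -
  have "used \<subseteq> {..<L p} - {j}" using used_less assms by auto
  then have "card used \<le> card ({..<L p} - {j})" by (intro card_mono) auto
  then show ?thesis using assms by simp
qed

lemma card_used_le_two:
  assumes "j < L p" "l < L p" "j \<noteq> l" "j \<notin> used" "l \<notin> used"
  shows "card used \<le> L p - 2"
proof -
  have "used \<subseteq> {..<L p} - {j, l}" using used_less assms by auto
  then have "card used \<le> card ({..<L p} - {j, l})" by (intro card_mono) auto
  also have "\<dots> = L p - 2" using assms by (subst card_Diff_subset) auto
  finally show ?thesis .
qed

lemma card_used_of_rest:
  assumes "t \<in> rest"
  shows "card used \<le> L p - 1"
proof -
  have L: "5 \<le> L p" by (rule L5)
  have low: "card used \<le> L p - 1" if "0 \<notin> used \<or> 1 \<notin> used"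
    using that card_used_le[of 0] card_used_le[of 1] L by auto
  consider a where "Pent a \<in> K" | i where "Join (\<not> p) i \<in> K" using assms by (auto simp: rest_def)
  then show ?thesis
  proof cases
    case (1 a)
    then consider "0 \<notin> used \<or> 1 \<notin> used" | "L p - 2 \<notin> used" | "L p - 1 \<notin> used"
      using unused_label_0_1[of a] unused_label_2_3[of a] unused_label_3_4[of a] label_cases[of a] by blast
    then show ?thesis
      by cases (use low card_used_le[of "L p - 2"] card_used_le[of "L p - 1"] L in simp_all)
  next
    case (2 i)
    then show ?thesis
    proof (cases rule: other_join_cases)
      case 1
      then have "0 \<notin> used \<or> 1 \<notin> used" using copies_0_1 by (auto simp: used_def)
      then show ?thesis by (rule low)
    next
      case 2
      then show ?thesis using card_used_le[of "L p - 1"] L by simp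
    qed
  qed
qed

text \<open>
  Two vertices of \<open>rest\<close> leave two different indices unused. Consecutive labels in general exclude
  different indices among \<open>L p - 2\<close>, \<open>L p - 1\<close> and one of 0, 1; the labels 0 and 1 both exclude only
  \<open>L p - 2\<close> by themselves, but jointly exclude index 2 as well: label 0 excludes \<open>Copy p 2\<close> and label 1
  excludes \<open>Join p 2\<close>.
\<close>

lemma card_used_of_rest_pair:
  assumes "t \<in> rest" "u \<in> rest" "t \<noteq> u"
  shows "card used \<le> L p - 2"
proof -
  have L: "5 \<le> L p" by (rule L5)
  have pent: "(pent_label p a = 0 \<or> pent_label p a = 1 \<longrightarrow> L p - 2 \<notin> used) \<and>
      (pent_label p a = 3 \<or> pent_label p a = 4 \<longrightarrow> L p - 1 \<notin> used) \<and>
      (pent_label p a = 2 \<or> pent_label p a = 3 \<longrightarrow> 0 \<notin> used \<or> 1 \<notin> used)" if "Pent a \<in> K" for a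
    using unused_label_0_1[OF that] unused_label_2_3[OF that] unused_label_3_4[OF that] by blast
  have "(L p - 2 \<notin> used \<and> L p - 1 \<notin> used) \<or> (L p - 2 \<notin> used \<and> (0 \<notin> used \<or> 1 \<notin> used)) \<or>
    (L p - 1 \<notin> used \<and> (0 \<notin> used \<or> 1 \<notin> used)) \<or> (L p - 2 \<notin> used \<and> 2 \<notin> used)"
    using assms
  proof (cases rule: rest_pair)
    case (1 a b)
    have "pent_label p a = 0 \<and> pent_label p b = 1 \<longrightarrow> 2 \<notin> used"
      "pent_label p b = 0 \<and> pent_label p a = 1 \<longrightarrow> 2 \<notin> used"
      using unused_labels_0_1 1 by blast+
    then show ?thesis
      using pent[OF 1(2)] pent[OF 1(3)] pent_adj[OF 1(2,3,1)]
      by (cases rule: label_cases[OF 1(2)]; cases rule: label_cases[OF 1(3)]) (simp_all add: cyc5_def)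
  next
    case (2 a i)
    from 2(2) show ?thesis
    proof (cases rule: other_join_cases)
      case 1
      then have "0 \<notin> used \<or> 1 \<notin> used" using copies_0_1 by (auto simp: used_def)
      then show ?thesis
        using pent[OF 2(1)] 1(2) 2(1) by (cases rule: label_cases[OF 2(1)]) auto
    next
      case join: 2
      show ?thesis
        using pent[OF 2(1)] join 2(1) by (cases rule: label_cases[OF 2(1)]) auto
    qed
  qed
  then show ?thesis
    using card_used_le_two[of "L p - 2" "L p - 1"] card_used_le_two[of "L p - 2" 0] card_used_le_two[of "L p - 2" 1]
      card_used_le_two[of "L p - 1" 0] card_used_le_two[of "L p - 1" 1] card_used_le_two[of "L p - 2" 2] L
    by auto
qed

text \<open>
  Here \<open>Join p j\<close> is the only one of its kind in \<open>K\<close>, since \<open>w p j\<close> is joined to the others in colour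
  \<open>\<not> p\<close>, and what is left are the copies with index other than \<open>j\<close> and \<open>rest\<close>. For \<open>j \<ge> 2\<close> one of the
  copies with index 0 and 1 is missing too. For \<open>j < 2\<close> the set \<open>pent_off\<close> leaves only the labels 4, 0
  and 1, so that two vertices in \<open>rest\<close> force the label 0, which excludes all copies with
  index at least 2; as \<open>L p \<ge> 5\<close>, there is at least one.
\<close>

lemma card_clique_join_old:
  assumes join: "Join p j \<in> K" and old: "Old x \<in> K"
  shows "card K \<le> L p"
proof -
  have x: "x = w p j" "j + 2 < L p" using adj[OF join old] by (auto split: if_splits)
  have only_j: "l = j" if "Join p l \<in> K" for l
    using adj[OF that old] x w_inj[of l p j] by (auto split: if_splits)
  have only_x: "y = x" if "Old y \<in> K" for y
    using adj[OF join that] x by (auto split: if_splits)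
  have no_other: "Copy (\<not> p) l \<notin> K" for l using adj[OF join, of "Copy (\<not> p) l"] by auto
  define D where "D = {l. Copy p l \<in> K}"
  have D: "D \<subseteq> {..<L p - 2} - {j}"
    using adj[OF join, of "Copy p j"] in_verts by (fastforce simp: D_def)
  have D2: "card D \<le> L p - 4" if e: "e \<notin> D" "e \<noteq> j" "e + 2 < L p" for e
  proof -
    have "D \<subseteq> {..<L p - 2} - {j, e}" using D e by auto
    then have "card D \<le> card ({..<L p - 2} - {j, e})" by (intro card_mono) auto
    also have "\<dots> = L p - 4" using x(2) e by (subst card_Diff_subset) auto
    finally show ?thesis .
  qed
  \<comment> \<open>Together with \<open>Old x\<close> and \<open>Join p j\<close> this gives \<open>L p\<close> vertices.\<close>
  have bound: "card D + card rest \<le> L p - 2"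
  proof (cases "2 \<le> j")
    case True
    have "0 \<notin> D \<or> 1 \<notin> D" using copies_0_1 by (auto simp: D_def)
    then have "card D \<le> L p - 4" using D2[of 0] D2[of 1] True x(2) by auto
    then show ?thesis using card_rest_le_2 L5[of p] by linarith
  next
    case False
    show ?thesis
    proof (cases "card rest = 2")
      case True
      then obtain t u where tu: "t \<in> rest" "u \<in> rest" "t \<noteq> u" by (auto simp: card_2_iff)
      have off: "pent_label p a \<noteq> 2 \<and> pent_label p a \<noteq> 3" if "Pent a \<in> K" for a
        using join_pent[OF join that] False by (auto simp: pent_off_def)
      have "\<exists>a. Pent a \<in> K \<and> pent_label p a = 0"
        using tu
      proof (cases rule: rest_pair)
        case (1 a b)
        then have "pent_label p a = 0 \<or> pent_label p b = 0"
          using pent_adj[OF 1(2,3,1)] off[OF 1(2)] off[OF 1(3)]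
          by (cases rule: label_cases[OF 1(2)]; cases rule: label_cases[OF 1(3)]) (simp_all add: cyc5_def)
        then show ?thesis using 1 by blast
      next
        case (2 a i)
        from 2(2) show ?thesis
        proof (cases rule: other_join_cases)
          case 1
          then show ?thesis using False join by force
        next
          case join: 2
          then show ?thesis using 2(1) off by (metis label_cases)
        qed
      qed
      then have "2 \<notin> D" using copy_label_0 by (auto simp: D_def)
      then show ?thesis using D2[of 2] True False L5[of p] by auto
    next
      case rest: False
      have "card D \<le> card ({..<L p - 2} - {j})" using D by (intro card_mono) auto
      also have "\<dots> = L p - 3" using x(2) by simp
      finally show ?thesis using rest card_rest_le_2 L5[of p] by linarith
    qed
  qed
  have "K \<subseteq> {Old x, Join p j} \<union> (Copy p ` D \<union> rest)"
  proof
    fix y assume y: "y \<in> K"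
    show "y \<in> {Old x, Join p j} \<union> (Copy p ` D \<union> rest)"
    proof (cases y)
      case (Copy q l)
      then show ?thesis using y no_other[of l] by (cases "q = p") (auto simp: D_def)
    next
      case (Join q l)
      then show ?thesis using y only_j[of l] by (cases "q = p") (auto simp: rest_def)
    qed (use y only_x in \<open>auto simp: rest_def\<close>)
  qed
  moreover have fin: "finite rest" "finite D"
    using finite_K D finite_subset by (auto simp: rest_def)
  ultimately have "card K \<le> card ({Old x, Join p j} \<union> (Copy p ` D \<union> rest))" by (intro card_mono) auto
  also have "\<dots> \<le> card {Old x, Join p j} + (card ((Copy p :: nat \<Rightarrow> 'a vertex) ` D) + card rest)"
    using card_Un_le[of "{Old x, Join p j}" "Copy p ` D \<union> rest"] card_Un_le[of "Copy p ` D" rest]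
    by linarith
  also have "\<dots> \<le> 2 + (card D + card rest)" using card_image_le[OF fin(2), of "Copy p"] by simp
  finally show ?thesis using bound L5[of p] by linarith
qed

text \<open>
  Every vertex of \<open>K\<close> outside \<open>rest\<close> uses up an index of its own, and \<open>rest\<close> leaves as many indices
  unused as it has elements.
\<close>

lemma card_clique_join_no_old:
  assumes join: "Join p j \<in> K" and no_old: "\<And>x. Old x \<notin> K"
  shows "card K \<le> L p"
proof -
  have no_other: "Copy (\<not> p) l \<notin> K" for l using adj[OF join, of "Copy (\<not> p) l"] by auto
  define f :: "nat \<Rightarrow> 'a vertex"
    where "f l = (if Copy p l \<in> K then Copy p l else Join p l)" for l
  have "K \<subseteq> f ` used \<union> rest"
  proof
    fix y assume y: "y \<in> K"
    show "y \<in> f ` used \<union> rest"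
    proof (cases y)
      case (Copy q l)
      then show ?thesis using y no_other[of l] by (cases "q = p") (auto simp: used_def f_def)
    next
      case (Join q l)
      then show ?thesis using y adj[of "Join p l" "Copy p l"]
        by (cases "q = p") (auto simp: rest_def used_def f_def)
    qed (use y no_old in \<open>auto simp: rest_def\<close>)
  qed
  moreover have sub: "used \<subseteq> {..<L p}" using used_less by auto
  then have fin: "finite rest" "finite used" using finite_K finite_subset by (auto simp: rest_def)
  ultimately have "card K \<le> card (f ` used \<union> rest)" by (intro card_mono) auto
  also have "\<dots> \<le> card used + card rest"
    using card_Un_le[of "f ` used" rest] card_image_le[OF fin(2), of f] by linarith
  also have "\<dots> \<le> L p"
  proof -
    consider "card rest = 0" | "card rest = 1" | "card rest = 2" using card_rest_le_2 by linarith
    then show ?thesis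
    proof cases
      case 1
      then show ?thesis using card_mono[OF _ sub] by simp
    next
      case 2
      then obtain t where "t \<in> rest" by (auto simp: card_1_singleton_iff)
      then show ?thesis using card_used_of_rest 2 L5[of p] by fastforce
    next
      case 3
      then obtain t u where "t \<in> rest" "u \<in> rest" "t \<noteq> u" by (auto simp: card_2_iff)
      then show ?thesis using card_used_of_rest_pair 3 L5[of p] by fastforce
    qed
  qed
  finally show ?thesis .
qed

lemma card_clique_le: "card K \<le> L p"
proof (cases "\<exists>j. Join p j \<in> K")
  case True
  then obtain j where j: "Join p j \<in> K" by blast
  show ?thesis
  proof (cases "\<exists>x. Old x \<in> K")
    case True
    then show ?thesis using card_clique_join_old[OF j] by blast
  next
    case False
    then show ?thesis using card_clique_join_no_old[OF j] by blast
  qed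
next
  case False
  then show ?thesis using card_clique_without_join by blast
qed

end

lemma avoiding_verts: "avoiding verts col (\<lambda>p. L p + 1)"
  unfolding avoiding_def
proof (intro conjI allI impI)
  show "col x y = col y x" for x y by (rule col_sym)
  show "card K < L p + 1" if "K \<subseteq> verts" "mono_clique col p K" for p K
    using card_clique_le[OF that] by simp
qed

end

section \<open>The inequality\<close>

lemma critical_clique_enumeration:
  assumes "avoiding X c L" "finite X" "v \<in> X" "z \<notin> X" "\<nexists>c'. avoiding (insert z X) c' L"
  shows "\<exists>f. inj_on f {j. j + 2 < L p} \<and>
    (\<forall>j. j + 2 < L p \<longrightarrow> f j \<in> X \<and> f j \<noteq> v \<and> c (f j) v = p) \<and>
    (\<forall>j l. j + 2 < L p \<longrightarrow> l + 2 < L p \<longrightarrow> j \<noteq> l \<longrightarrow> c (f j) (f l) = p)"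
proof -
  obtain K where K: "K \<subseteq> X" "mono_clique c p K" "v \<in> K" "L p \<le> Suc (card K)"
    using critical_vertex_in_clique[OF assms(1,3,4,5)] by blast
  have "finite K" using K(1) assms(2) by (rule finite_subset)
  then have "L p - 2 \<le> card (K - {v})" using K(3,4) by (simp add: card_Diff_singleton)
  then obtain N where N: "N \<subseteq> K - {v}" "card N = L p - 2" "finite N"
    by (metis obtain_subset_with_card_n)
  obtain f where "bij_betw f {0..<L p - 2} N" using ex_bij_betw_nat_finite[OF N(3)] N(2) by auto
  moreover have "{0..<L p - 2} = {j. j + 2 < L p}" by auto
  ultimately have f: "inj_on f {j. j + 2 < L p}" "\<And>j. j + 2 < L p \<Longrightarrow> f j \<in> N"
    by (auto simp: bij_betw_def)
  have fK: "f j \<in> K \<and> f j \<noteq> v" if "j + 2 < L p" for j using f(2)[OF that] N(1) by auto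
  have "c (f j) (f l) = p" if "j + 2 < L p" "l + 2 < L p" "j \<noteq> l" for j l
  proof (rule mono_cliqueD[OF K(2)])
    show "f j \<noteq> f l" using f(1) that by (auto dest: inj_onD)
  qed (use fK that in auto)
  moreover have "c (f j) v = p" if "j + 2 < L p" for j
    using mono_cliqueD[OF K(2)] fK[OF that] K(3) by blast
  ultimately show ?thesis using f(1) fK K(1) by blast
qed

theorem theorem1p1:
  fixes k s :: nat
  assumes "k \<ge> 5" and "s \<ge> 5"
  shows "ramsey_number (k + 1) (s + 1) \<ge> ramsey_number k s + 2 * k + 2 * s"
proof -
  define L where "L = (\<lambda>p. if p then k else s)"
  have L5: "5 \<le> L p" for p using assms by (simp add: L_def)
  have "card K < L p" if "K \<subseteq> {0::nat}" for K p
    using card_mono[OF _ that] L5[of p] by simp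
  then have "avoiding {0::nat} (\<lambda>x y. True) L" by (simp add: avoiding_def)
  then have "1 < ramsey_number k s" using card_less_ramsey_number[of "{0::nat}"] by (simp add: L_def)
  then obtain n where n: "ramsey_number k s = Suc n" "0 < n" by (cases "ramsey_number k s") auto
  obtain c where c: "avoiding {..<n} c L"
    using avoiding_below_ramsey_number[of n k s] n(1) by (auto simp: L_def)
  have crit: "\<nexists>c'. avoiding (insert n {..<n}) c' L"
    using card_less_ramsey_number[of "insert n {..<n}" _ k s] n(1) by (auto simp: L_def)
  have "\<forall>p. \<exists>f. inj_on f {j. j + 2 < L p} \<and>
    (\<forall>j. j + 2 < L p \<longrightarrow> f j \<in> {..<n} \<and> f j \<noteq> 0 \<and> c (f j) 0 = p) \<and>
    (\<forall>j l. j + 2 < L p \<longrightarrow> l + 2 < L p \<longrightarrow> j \<noteq> l \<longrightarrow> c (f j) (f l) = p)"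
    by (intro allI critical_clique_enumeration[OF c _ _ _ crit]) (use n(2) in auto)
  from choice[OF this] obtain w where w: "\<And>p. inj_on (w p) {j. j + 2 < L p}"
    "\<And>p j. j + 2 < L p \<Longrightarrow> w p j \<in> {..<n} \<and> w p j \<noteq> 0 \<and> c (w p j) 0 = p"
    "\<And>p j l. j + 2 < L p \<Longrightarrow> l + 2 < L p \<Longrightarrow> j \<noteq> l \<Longrightarrow> c (w p j) (w p l) = p"
    by blast
  interpret critical_colouring "{..<n}" c L 0 w
  proof
    show "j = l" if "j + 2 < L p" "l + 2 < L p" "w p j = w p l" for p j l
      using inj_onD[OF w(1)] that by blast
  qed (use c L5 n(2) w in auto)
  have "(\<lambda>p. L p + 1) = (\<lambda>p. if p then k + 1 else s + 1)" by (auto simp: L_def)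
  then have "card verts < ramsey_number (k + 1) (s + 1)"
    using card_less_ramsey_number[OF finite_verts] avoiding_verts by metis
  then show ?thesis using card_verts n(1) by (simp add: L_def)
qed

end
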